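(* Let $X$ be a zero-dimensional Hausdorff space and let $A_c(X)$ be a ring with $C_c^*(X)\subseteq A_c(X)\subseteq C_c(X)$. Then the $z^0$-ideals in $A_c(X)$ are exactly the contractions of $z^0$-ideals in $C(X)$; that is, a subset $I\subseteq A_c(X)$ is a $z^0$-ideal of $A_c(X)$ if and only if $I=J\cap A_c(X)$ for some $z^0$-ideal $J$ of $C(X)$.
   Context: A space is zero-dimensional if its clopen sets form a base for its topology. $C(X)$ is the ring of real-valued continuous functions on $X$; $C_c(X)$ is the subring of those $f\in C(X)$ with countable range, and $C_c^*(X)$ is the subring of bounded members of $C_c(X)$. Ideals are always proper. For a commutative reduced ring $R$ with unity and $a\in R$, let $\mathcal P_a$ be the intersection of all minimal prime ideals of $R$ containing $a$ (an empty intersection being $R$); an ideal $I$ of $R$ is a $z^0$-ideal if $\mathcal P_a\subseteq I$ for every $a\in I$. *)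

theory Defs
  imports "HOL-Analysis.Analysis" "HOL-Algebra.Subrings"
begin

definition zero_dimensional :: "'a topology \<Rightarrow> bool" where
  "zero_dimensional X \<longleftrightarrow>
     openin X = arbitrary union_of (\<lambda>V. openin X V \<and> closedin X V)"

text \<open>Functions on the carrier \<open>topspace X\<close> are represented by functions that are
  \<^term>\<open>undefined\<close> outside it, so that HOL equality is equality on the space.\<close>

definition cont_ring :: "'a topology \<Rightarrow> ('a \<Rightarrow> real) ring" where
  "cont_ring X =
     \<lparr>carrier = {f \<in> extensional (topspace X). continuous_map X euclideanreal f},
      mult = (\<lambda>f g. \<lambda>x\<in>topspace X. f x * g x),
      one = (\<lambda>x\<in>topspace X. 1),
      zero = (\<lambda>x\<in>topspace X. 0),
      add = (\<lambda>f g. \<lambda>x\<in>topspace X. f x + g x)\<rparr>"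

definition cont_countable :: "'a topology \<Rightarrow> ('a \<Rightarrow> real) set" where
  "cont_countable X = {f \<in> carrier (cont_ring X). countable (f ` topspace X)}"

definition cont_countable_bounded :: "'a topology \<Rightarrow> ('a \<Rightarrow> real) set" where
  "cont_countable_bounded X = {f \<in> cont_countable X. bounded (f ` topspace X)}"

definition minimal_primeideal :: "'b set \<Rightarrow> ('b, 'm) ring_scheme \<Rightarrow> bool" where
  "minimal_primeideal P R \<longleftrightarrow>
     primeideal P R \<and> (\<forall>Q. primeideal Q R \<and> Q \<subseteq> P \<longrightarrow> Q = P)"

text \<open>Intersecting with \<open>carrier R\<close> makes the empty intersection equal to the whole ring.\<close>

definition minimal_prime_hull :: "('b, 'm) ring_scheme \<Rightarrow> 'b \<Rightarrow> 'b set" where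
  "minimal_prime_hull R a = carrier R \<inter> \<Inter>{P. minimal_primeideal P R \<and> a \<in> P}"

definition z0_ideal :: "'b set \<Rightarrow> ('b, 'm) ring_scheme \<Rightarrow> bool" where
  "z0_ideal I R \<longleftrightarrow>
     ideal I R \<and> I \<noteq> carrier R \<and> (\<forall>a\<in>I. minimal_prime_hull R a \<subseteq> I)"

lemma cring_cont_ring: "cring (cont_ring X)"
proof (rule cringI)
  show "abelian_group (cont_ring X)"
  proof (rule abelian_groupI)
    fix f assume f: "f \<in> carrier (cont_ring X)"
    let ?g = "\<lambda>x\<in>topspace X. - f x"
    have "continuous_map X euclideanreal ?g"
      using f by (auto simp: cont_ring_def intro!: continuous_map_minus
          intro: continuous_map_eq[of _ _ "\<lambda>x. - f x"])
    then show "\<exists>g\<in>carrier (cont_ring X). g \<oplus>\<^bsub>cont_ring X\<^esub> f = \<zero>\<^bsub>cont_ring X\<^esub>"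
      by (intro bexI[of _ ?g]) (auto simp: cont_ring_def fun_eq_iff)
  next
    fix f g assume "f \<in> carrier (cont_ring X)" "g \<in> carrier (cont_ring X)"
    then show "f \<oplus>\<^bsub>cont_ring X\<^esub> g \<in> carrier (cont_ring X)"
      by (auto simp: cont_ring_def intro: continuous_map_eq[OF continuous_map_add])
  qed (auto simp: cont_ring_def fun_eq_iff extensional_def
        intro: continuous_map_eq[of _ _ "\<lambda>x. 0"])
  show "Group.comm_monoid (cont_ring X)"
  proof (rule comm_monoidI)
    fix f g assume "f \<in> carrier (cont_ring X)" "g \<in> carrier (cont_ring X)"
    then show "f \<otimes>\<^bsub>cont_ring X\<^esub> g \<in> carrier (cont_ring X)"
      by (auto simp: cont_ring_def intro: continuous_map_eq[OF continuous_map_real_mult])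
  qed (auto simp: cont_ring_def fun_eq_iff extensional_def
        intro: continuous_map_eq[of _ _ "\<lambda>x. 1"])
qed (auto simp: cont_ring_def fun_eq_iff algebra_simps)

lemma cont_ring_reduced:
  assumes "f \<in> carrier (cont_ring X)" "f [^]\<^bsub>cont_ring X\<^esub> (n::nat) = \<zero>\<^bsub>cont_ring X\<^esub>"
  shows "f = \<zero>\<^bsub>cont_ring X\<^esub>"
proof -
  have "\<forall>x\<in>topspace X. (f [^]\<^bsub>cont_ring X\<^esub> n) x = f x ^ n"
    by (induction n) (auto simp: cont_ring_def nat_pow_def)
  with assms show ?thesis
    by (auto simp: cont_ring_def fun_eq_iff extensional_def restrict_def)
qed

end

(* In a reduced commutative ring, maximal multiplicatively closed sets avoiding 0 are the
   complements of minimal primes, and this yields P_a = {b. Ann a \<subseteq> Ann b}.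
   In C(X), and equally in every subring containing the indicators of clopen sets,
   Ann f \<subseteq> Ann g means int Z(f) \<subseteq> Z(g), because clopen sets form a base.
   So both rings have the same z0-closure condition: z0-ideals contract, and a z0-ideal I of A
   is the contraction of {g. int Z(f) \<subseteq> Z(g) for some f in I}, which is closed under addition
   because Z(f\<^sup>2 + f'\<^sup>2) = Z(f) \<inter> Z(f'). *)

theory Submission
  imports Defs
begin

section \<open>Minimal primes and annihilators in reduced commutative rings\<close>

locale reduced_cring = cring +
  assumes square_eq_zero: "\<lbrakk>x \<in> carrier R; x \<otimes> x = \<zero>\<rbrakk> \<Longrightarrow> x = \<zero>"
begin

text \<open>Complements of prime ideals have this form, so enlarging such a set corresponds to
  shrinking a prime; Zorn's lemma is applied on this side.\<close>

definition mult_closed_nonzero :: "'a set \<Rightarrow> bool" where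
  "mult_closed_nonzero M \<longleftrightarrow> M \<subseteq> carrier R \<and> \<one> \<in> M \<and> \<zero> \<notin> M \<and> (\<forall>x\<in>M. \<forall>y\<in>M. x \<otimes> y \<in> M)"

text \<open>The square of \<open>s \<otimes> x [^] Suc m\<close> has
  \<open>s \<otimes> x [^] Suc (Suc m)\<close> as a factor, so reducedness for squares lowers the
  exponent one step at a time.\<close>

lemma mult_pow_eq_zero:
  assumes "s \<in> carrier R" "x \<in> carrier R" "s \<otimes> x [^] (n::nat) = \<zero>"
  shows "s \<otimes> x = \<zero>"
  using assms(3)
proof (induction n)
  case 0
  then show ?case using assms by simp
next
  case (Suc n)
  show ?case
  proof (cases n)
    case 0
    then show ?thesis using Suc assms by simp
  next
    case (Suc m)
    let ?y = "s \<otimes> x [^] Suc m"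
    have "?y \<in> carrier R" using assms(1,2) by simp
    have "?y \<otimes> ?y = (s \<otimes> x [^] Suc (Suc m)) \<otimes> (s \<otimes> x [^] m)"
      using assms by (simp add: m_ac)
    also have "\<dots> = \<zero>" using Suc.prems Suc assms by simp
    finally have "?y = \<zero>" by (rule square_eq_zero[OF \<open>?y \<in> carrier R\<close>])
    then show ?thesis using Suc.IH Suc by simp
  qed
qed

text \<open>Take all products \<open>s \<otimes> x [^] n\<close> with \<open>s\<close> in
  \<open>M\<close>. By \<open>mult_pow_eq_zero\<close>, if one of them vanished then so would
  \<open>s \<otimes> x\<close>, which is why testing the first power is enough.\<close>

lemma mult_closed_nonzero_adjoin:
  assumes M: "mult_closed_nonzero M" and x: "x \<in> carrier R"
    and nz: "\<And>s. s \<in> M \<Longrightarrow> s \<otimes> x \<noteq> \<zero>"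
  obtains N where "mult_closed_nonzero N" "M \<subseteq> N" "x \<in> N"
proof -
  have sub: "M \<subseteq> carrier R" using M by (simp add: mult_closed_nonzero_def)
  let ?N = "{s \<otimes> x [^] (n::nat) |s n. s \<in> M}"
  have "mult_closed_nonzero ?N"
    unfolding mult_closed_nonzero_def
  proof (intro conjI ballI)
    show "?N \<subseteq> carrier R" using sub x by auto
    have "\<one> = \<one> \<otimes> x [^] (0::nat)" by simp
    then show "\<one> \<in> ?N" using M unfolding mult_closed_nonzero_def by blast
    show "\<zero> \<notin> ?N"
      using nz mult_pow_eq_zero sub x by (smt (verit) mem_Collect_eq subsetD)
  next
    fix u v assume "u \<in> ?N" "v \<in> ?N"
    then obtain s m t n where uv: "u = s \<otimes> x [^] (m::nat)" "v = t \<otimes> x [^] (n::nat)"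
      and st: "s \<in> M" "t \<in> M" by blast
    have "u \<otimes> v = (s \<otimes> t) \<otimes> x [^] (m + n)"
      using st sub x by (auto simp: uv m_ac subset_iff nat_pow_mult[symmetric])
    moreover have "s \<otimes> t \<in> M" using M st by (simp add: mult_closed_nonzero_def)
    ultimately show "u \<otimes> v \<in> ?N" by blast
  qed
  moreover have "M \<subseteq> ?N"
  proof
    fix s assume "s \<in> M"
    moreover have "s = s \<otimes> x [^] (0::nat)" using \<open>s \<in> M\<close> sub by auto
    ultimately show "s \<in> ?N" by blast
  qed
  moreover have "x \<in> ?N"
  proof -
    have "x = \<one> \<otimes> x [^] (1::nat)" using x by simp
    then show ?thesis using M unfolding mult_closed_nonzero_def by blast
  qed
  ultimately show thesis using that by blast
qed

lemma mult_closed_nonzero_complement_prime: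
  assumes "primeideal Q R"
  shows "mult_closed_nonzero (carrier R - Q)"
proof -
  interpret Q: primeideal Q R by fact
  show ?thesis
    unfolding mult_closed_nonzero_def
    using Q.I_prime Q.one_imp_carrier Q.I_notcarr Q.zero_closed by auto
qed

text \<open>Maximality forbids adjoining anything new, so an element lies outside \<open>M\<close>
  exactly when some member of \<open>M\<close> annihilates it. This description (\<open>ann\<close>)
  gives the ideal laws, and multiplicative closure of \<open>M\<close> gives primality.\<close>

lemma complement_maximal_minimal_primeideal:
  assumes M: "mult_closed_nonzero M"
    and max: "\<And>N. \<lbrakk>mult_closed_nonzero N; M \<subseteq> N\<rbrakk> \<Longrightarrow> N = M"
  shows "minimal_primeideal (carrier R - M) R"
proof -
  have sub: "M \<subseteq> carrier R" and one: "\<one> \<in> M" and zero: "\<zero> \<notin> M"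
    and mult: "\<And>x y. \<lbrakk>x \<in> M; y \<in> M\<rbrakk> \<Longrightarrow> x \<otimes> y \<in> M"
    using M by (auto simp: mult_closed_nonzero_def)
  have ann: "x \<notin> M \<longleftrightarrow> (\<exists>s\<in>M. s \<otimes> x = \<zero>)" if "x \<in> carrier R" for x
  proof
    assume "x \<notin> M"
    then show "\<exists>s\<in>M. s \<otimes> x = \<zero>"
      using mult_closed_nonzero_adjoin[OF M that] max by metis
  next
    assume "\<exists>s\<in>M. s \<otimes> x = \<zero>"
    then show "x \<notin> M" using mult zero by metis
  qed
  have "ideal (carrier R - M) R"
  proof (rule idealI)
    show "ring R" by (rule ring_axioms)
    show "subgroup (carrier R - M) (add_monoid R)"
    proof (rule subgroup.intro)
      fix x y assume xy: "x \<in> carrier R - M" "y \<in> carrier R - M"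
      then obtain s t where st: "s \<in> M" "s \<otimes> x = \<zero>" "t \<in> M" "t \<otimes> y = \<zero>"
        using ann by (metis DiffE)
      then have c: "s \<in> carrier R" "t \<in> carrier R" "x \<in> carrier R" "y \<in> carrier R"
        using sub xy by auto
      \<comment> \<open>The product of an annihilator of \<open>x\<close> and one of
        \<open>y\<close> stays in \<open>M\<close> and annihilates the sum.\<close>
      have "(s \<otimes> t) \<otimes> (x \<oplus> y) = t \<otimes> (s \<otimes> x) \<oplus> s \<otimes> (t \<otimes> y)"
        using c by (simp add: r_distr m_ac)
      also have "\<dots> = \<zero>" using st c by simp
      finally have "x \<oplus> y \<notin> M" using ann c mult st by (metis add.m_closed)
      then show "x \<otimes>\<^bsub>add_monoid R\<^esub> y \<in> carrier R - M" using c by simp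
    next
      fix x assume x: "x \<in> carrier R - M"
      then obtain s where s: "s \<in> M" "s \<otimes> x = \<zero>" using ann by (metis DiffE)
      then have "s \<otimes> (\<ominus> x) = \<zero>" using sub x by (auto simp: r_minus)
      then have "\<ominus> x \<notin> M" using ann s x by (metis DiffE add.inv_closed)
      then show "inv\<^bsub>add_monoid R\<^esub> x \<in> carrier R - M" using x by (simp flip: a_inv_def)
    qed (use zero in auto)
  next
    fix x r assume x: "x \<in> carrier R - M" and r: "r \<in> carrier R"
    then obtain s where s: "s \<in> M" "s \<otimes> x = \<zero>" using ann by (metis DiffE)
    then have "s \<otimes> (r \<otimes> x) = r \<otimes> (s \<otimes> x)" using sub x r by (auto simp: m_ac subset_iff)
    then have "r \<otimes> x \<notin> M" using ann s x r by (metis DiffE m_closed r_null)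
    then show "r \<otimes> x \<in> carrier R - M" "x \<otimes> r \<in> carrier R - M"
      using x r by (auto simp: m_comm)
  qed
  then have "primeideal (carrier R - M) R"
    by (intro primeidealI) (use one mult cring_axioms in auto)
  moreover have "Q = carrier R - M" if "primeideal Q R" "Q \<subseteq> carrier R - M" for Q
  proof -
    \<comment> \<open>A smaller prime has a larger complement, and \<open>M\<close> cannot be
      enlarged.\<close>
    have "carrier R - Q = M"
      using max mult_closed_nonzero_complement_prime[OF that(1)] that(2) sub by blast
    then show ?thesis using that(2) by blast
  qed
  ultimately show ?thesis by (auto simp: minimal_primeideal_def)
qed

text \<open>Zorn's lemma enlarges \<open>S\<close> to a maximal set of the same kind, whose
  complement is the desired prime.\<close>

lemma minimal_primeideal_avoiding:
  assumes S: "mult_closed_nonzero S"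
  obtains P where "minimal_primeideal P R" "P \<inter> S = {}"
proof -
  have "\<exists>M\<in>{N. mult_closed_nonzero N \<and> S \<subseteq> N}.
      \<forall>N\<in>{N. mult_closed_nonzero N \<and> S \<subseteq> N}. M \<subseteq> N \<longrightarrow> N = M"
  proof (rule subset_Zorn_nonempty)
    show "{N. mult_closed_nonzero N \<and> S \<subseteq> N} \<noteq> {}" using S by auto
  next
    fix \<C> assume ne: "\<C> \<noteq> {}" and chain: "subset.chain {N. mult_closed_nonzero N \<and> S \<subseteq> N} \<C>"
    then have *: "mult_closed_nonzero N \<and> S \<subseteq> N" if "N \<in> \<C>" for N
      using that by (auto simp: subset_chain_def)
    have "x \<otimes> y \<in> \<Union>\<C>" if "x \<in> \<Union>\<C>" "y \<in> \<Union>\<C>" for x y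
    proof -
      obtain N where "N \<in> \<C>" "x \<in> N" "y \<in> N"
        using \<open>x \<in> \<Union>\<C>\<close> \<open>y \<in> \<Union>\<C>\<close> chain unfolding subset_chain_def by blast
      then show ?thesis using * unfolding mult_closed_nonzero_def by blast
    qed
    \<comment> \<open>Nonemptiness of the chain is what puts \<open>\<one>\<close> into the
      union.\<close>
    then have "mult_closed_nonzero (\<Union>\<C>)"
      using * ne unfolding mult_closed_nonzero_def by blast
    then show "\<Union>\<C> \<in> {N. mult_closed_nonzero N \<and> S \<subseteq> N}" using * ne by blast
  qed
  then obtain M where "mult_closed_nonzero M" "S \<subseteq> M"
    "\<And>N. \<lbrakk>mult_closed_nonzero N; M \<subseteq> N\<rbrakk> \<Longrightarrow> N = M"
    by (smt (verit) mem_Collect_eq order_trans)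
  then show thesis
    using that[of "carrier R - M"] complement_maximal_minimal_primeideal by blast
qed

text \<open>A nonzero \<open>a\<close> can be adjoined to \<open>{\<one>}\<close>, and a minimal
  prime avoiding the resulting set omits \<open>a\<close>.\<close>

lemma Inter_minimal_primeideals:
  assumes "a \<in> carrier R" "\<And>P. minimal_primeideal P R \<Longrightarrow> a \<in> P"
  shows "a = \<zero>"
proof (rule ccontr)
  assume a: "a \<noteq> \<zero>"
  have "\<one> \<noteq> \<zero>" using a assms(1) by (metis r_null r_one)
  then have "mult_closed_nonzero {\<one>}" by (simp add: mult_closed_nonzero_def)
  then obtain N where "mult_closed_nonzero N" "a \<in> N"
    using mult_closed_nonzero_adjoin[of "{\<one>}" a] a assms(1) by auto
  then show False using minimal_primeideal_avoiding assms(2) by blast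
qed

text \<open>Otherwise \<open>a\<close> could be adjoined to the complement of \<open>P\<close>. A
  minimal prime avoiding the enlarged set would lie inside \<open>P\<close>, hence equal
  \<open>P\<close> by minimality, and yet omit \<open>a\<close>.\<close>

lemma minimal_primeideal_annihilator:
  assumes P: "minimal_primeideal P R" and a: "a \<in> P"
  obtains c where "c \<in> carrier R - P" "c \<otimes> a = \<zero>"
proof -
  interpret P: primeideal P R using P by (simp add: minimal_primeideal_def)
  have "\<exists>c \<in> carrier R - P. c \<otimes> a = \<zero>"
  proof (rule ccontr)
    assume "\<not> ?thesis"
    then obtain N where N: "mult_closed_nonzero N" "carrier R - P \<subseteq> N" "a \<in> N"
      using mult_closed_nonzero_adjoin[OF mult_closed_nonzero_complement_prime[OF P.primeideal_axioms]]
        a P.Icarr by metis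
    then obtain Q where Q: "minimal_primeideal Q R" "Q \<inter> N = {}"
      using minimal_primeideal_avoiding by blast
    interpret Q: primeideal Q R using Q by (simp add: minimal_primeideal_def)
    have "Q \<subseteq> P" using Q N(2) Q.Icarr by blast
    then have "Q = P" using P Q.primeideal_axioms by (simp add: minimal_primeideal_def)
    then show False using a N Q by blast
  qed
  then show thesis using that by blast
qed

text \<open>If \<open>c\<close> kills \<open>a\<close>, every minimal prime contains
  \<open>c\<close> or \<open>a\<close>, hence \<open>c\<close> or \<open>b\<close>; so
  \<open>c \<otimes> b\<close> lies in all of them and vanishes. Conversely, for a minimal prime
  containing \<open>a\<close>, an annihilator of \<open>a\<close> outside it also kills
  \<open>b\<close>, and primality applies.\<close>

lemma mem_minimal_prime_hull_iff:
  assumes a: "a \<in> carrier R" and b: "b \<in> carrier R"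
  shows "b \<in> minimal_prime_hull R a \<longleftrightarrow> (\<forall>c\<in>carrier R. c \<otimes> a = \<zero> \<longrightarrow> c \<otimes> b = \<zero>)"
proof
  assume hull: "b \<in> minimal_prime_hull R a"
  show "\<forall>c\<in>carrier R. c \<otimes> a = \<zero> \<longrightarrow> c \<otimes> b = \<zero>"
  proof (intro ballI impI)
    fix c assume c: "c \<in> carrier R" "c \<otimes> a = \<zero>"
    show "c \<otimes> b = \<zero>"
    proof (rule Inter_minimal_primeideals)
      fix P assume P: "minimal_primeideal P R"
      then interpret P: primeideal P R by (simp add: minimal_primeideal_def)
      have "c \<in> P \<or> a \<in> P" using P.I_prime[of c a] c a P.zero_closed by auto
      then have "c \<in> P \<or> b \<in> P" using hull P by (auto simp: minimal_prime_hull_def)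
      then show "c \<otimes> b \<in> P" using P.I_l_closed P.I_r_closed b c by blast
    qed (use b c in auto)
  qed
next
  assume ann: "\<forall>c\<in>carrier R. c \<otimes> a = \<zero> \<longrightarrow> c \<otimes> b = \<zero>"
  have "b \<in> P" if P: "minimal_primeideal P R" "a \<in> P" for P
  proof -
    interpret P: primeideal P R using P by (simp add: minimal_primeideal_def)
    obtain c where "c \<in> carrier R - P" "c \<otimes> a = \<zero>"
      using minimal_primeideal_annihilator P by blast
    then show ?thesis using ann P.I_prime[of c b] b P.zero_closed by auto
  qed
  then show "b \<in> minimal_prime_hull R a" using b by (simp add: minimal_prime_hull_def)
qed

end

section \<open>Reducedness of function rings and their subrings\<close>

lemma reduced_cring_cont_ring: "reduced_cring (cont_ring X)"
proof -
  interpret cring "cont_ring X" by (rule cring_cont_ring)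
  show ?thesis
  proof
    fix f assume "f \<in> carrier (cont_ring X)" "f \<otimes>\<^bsub>cont_ring X\<^esub> f = \<zero>\<^bsub>cont_ring X\<^esub>"
    then show "f = \<zero>\<^bsub>cont_ring X\<^esub>"
      using cont_ring_reduced[of f X 2] by (simp add: numeral_2_eq_2)
  qed
qed

text \<open>This lets hulls be described by annihilators inside the subring itself, without
  comparing minimal primes of the two rings.\<close>

lemma reduced_cring_subring:
  assumes "reduced_cring R" "subring A R"
  shows "reduced_cring (R\<lparr>carrier := A\<rparr>)"
proof -
  interpret reduced_cring R by fact
  have sub: "A \<subseteq> carrier R" using assms(2) by (rule subringE)
  have "cring (R\<lparr>carrier := A\<rparr>)"
    using subcring_iff[OF sub] subcringI'[OF assms(2)] by simp
  then show ?thesis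
    using sub square_eq_zero by (auto simp: reduced_cring_def reduced_cring_axioms_def)
qed

section \<open>Annihilators and z0-ideals in terms of zero sets\<close>

definition zero_set :: "'a topology \<Rightarrow> ('a \<Rightarrow> real) \<Rightarrow> 'a set" where
  "zero_set X f = {x \<in> topspace X. f x = 0}"

definition clopen_indicator :: "'a topology \<Rightarrow> 'a set \<Rightarrow> 'a \<Rightarrow> real" where
  "clopen_indicator X K = (\<lambda>x\<in>topspace X. indicator K x)"

text \<open>Provides the test functions that any ring containing
  \<open>cont_countable_bounded X\<close> has for its annihilators.\<close>

lemma clopen_indicator_mem:
  assumes "openin X K" "closedin X K"
  shows "clopen_indicator X K \<in> cont_countable_bounded X"
proof -
  have "continuous_map X euclideanreal (clopen_indicator X K)"
    unfolding continuous_map_def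
  proof (intro conjI allI impI)
    fix U :: "real set"
    have "openin X (topspace X - K)" using assms(2) by auto
    moreover have "{x \<in> topspace X. clopen_indicator X K x \<in> U} =
        (if 1 \<in> U then K else {}) \<union> (if 0 \<in> U then topspace X - K else {})"
      using openin_subset[OF assms(1)] by (auto simp: clopen_indicator_def indicator_def)
    ultimately show "openin X {x \<in> topspace X. clopen_indicator X K x \<in> U}"
      using assms(1) by auto
  qed auto
  moreover have "clopen_indicator X K ` topspace X \<subseteq> {0, 1}"
    by (auto simp: clopen_indicator_def indicator_def)
  then have "finite (clopen_indicator X K ` topspace X)" by (rule finite_subset) simp
  ultimately show ?thesis
    by (auto simp: cont_countable_bounded_def cont_countable_def cont_ring_def
        clopen_indicator_def countable_finite finite_imp_bounded)
qed

lemma cont_ring_mult_eq_zero_iff: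
  "h \<otimes>\<^bsub>cont_ring X\<^esub> f = \<zero>\<^bsub>cont_ring X\<^esub> \<longleftrightarrow> (\<forall>x\<in>topspace X. h x = 0 \<or> f x = 0)"
  by (auto simp: cont_ring_def fun_eq_iff)

text \<open>Indicators of clopen sets detect the points of the interior, and conversely the
  nonvanishing set of an annihilator of \<open>f\<close> is open. The right-hand side does not
  mention \<open>A\<close>, which makes different rings comparable.\<close>

lemma annihilator_subset_iff:
  assumes zd: "zero_dimensional X" and sub: "A \<subseteq> carrier (cont_ring X)"
    and bdd: "cont_countable_bounded X \<subseteq> A"
  shows "(\<forall>h\<in>A. h \<otimes>\<^bsub>cont_ring X\<^esub> f = \<zero>\<^bsub>cont_ring X\<^esub> \<longrightarrow> h \<otimes>\<^bsub>cont_ring X\<^esub> g = \<zero>\<^bsub>cont_ring X\<^esub>)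
    \<longleftrightarrow> X interior_of zero_set X f \<subseteq> zero_set X g" (is "?ann \<longleftrightarrow> ?int")
proof
  assume ann: ?ann
  show ?int
  proof
    fix x assume x: "x \<in> X interior_of zero_set X f"
    have "(arbitrary union_of (\<lambda>V. openin X V \<and> closedin X V)) (X interior_of zero_set X f)"
      using zd openin_interior_of unfolding zero_dimensional_def by metis
    then obtain \<U> where \<U>: "\<U> \<subseteq> Collect (\<lambda>V. openin X V \<and> closedin X V)"
        "\<Union>\<U> = X interior_of zero_set X f"
      by (auto simp: union_of_def)
    then obtain K where "K \<in> \<U>" "x \<in> K" using x by (metis UnionE)
    then have K: "openin X K" "closedin X K" "x \<in> K" "K \<subseteq> X interior_of zero_set X f"
      using \<U> by auto
    \<comment> \<open>\<open>K\<close> is a clopen neighbourhood of \<open>x\<close> on which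
      \<open>f\<close> vanishes.\<close>
    have "clopen_indicator X K \<otimes>\<^bsub>cont_ring X\<^esub> f = \<zero>\<^bsub>cont_ring X\<^esub>"
      using K(4) interior_of_subset[of X "zero_set X f"]
      by (auto simp: cont_ring_mult_eq_zero_iff clopen_indicator_def zero_set_def indicator_def)
    then have "clopen_indicator X K \<otimes>\<^bsub>cont_ring X\<^esub> g = \<zero>\<^bsub>cont_ring X\<^esub>"
      using ann clopen_indicator_mem[OF K(1,2)] bdd by blast
    then show "x \<in> zero_set X g"
      using K(3) openin_subset[OF K(1)]
      by (force simp: cont_ring_mult_eq_zero_iff clopen_indicator_def zero_set_def)
  qed
next
  assume int: ?int
  show ?ann
  proof (intro ballI impI)
    fix h assume h: "h \<in> A" "h \<otimes>\<^bsub>cont_ring X\<^esub> f = \<zero>\<^bsub>cont_ring X\<^esub>"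
    have "continuous_map X euclideanreal h" using h(1) sub by (auto simp: cont_ring_def)
    \<comment> \<open>This is the set where \<open>h\<close> does not vanish. It is an open subset
      of the zero set of \<open>f\<close>, so it lies in the interior.\<close>
    then have "openin X {x \<in> topspace X. h x \<in> - {0}}"
      by (rule openin_continuous_map_preimage) auto
    moreover have "{x \<in> topspace X. h x \<in> - {0}} \<subseteq> zero_set X f"
      using h(2) by (auto simp: cont_ring_mult_eq_zero_iff zero_set_def)
    ultimately have "{x \<in> topspace X. h x \<in> - {0}} \<subseteq> zero_set X g"
      using int by (meson interior_of_maximal order_trans)
    then show "h \<otimes>\<^bsub>cont_ring X\<^esub> g = \<zero>\<^bsub>cont_ring X\<^esub>"
      by (auto simp: cont_ring_mult_eq_zero_iff zero_set_def)
  qed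
qed

text \<open>Minimal primes are eliminated: hull membership becomes annihilator inclusion, which
  becomes a condition on zero sets.\<close>

lemma z0_ideal_iff:
  assumes zd: "zero_dimensional X" and A: "subring A (cont_ring X)"
    and bdd: "cont_countable_bounded X \<subseteq> A"
  shows "z0_ideal I ((cont_ring X)\<lparr>carrier := A\<rparr>) \<longleftrightarrow>
    ideal I ((cont_ring X)\<lparr>carrier := A\<rparr>) \<and> I \<noteq> A \<and>
    (\<forall>f\<in>I. \<forall>g\<in>A. X interior_of zero_set X f \<subseteq> zero_set X g \<longrightarrow> g \<in> I)"
proof -
  interpret reduced_cring "(cont_ring X)\<lparr>carrier := A\<rparr>"
    using reduced_cring_subring[OF reduced_cring_cont_ring A] .
  have sub: "A \<subseteq> carrier (cont_ring X)" using A by (rule subringE)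
  have "minimal_prime_hull ((cont_ring X)\<lparr>carrier := A\<rparr>) f \<subseteq> I \<longleftrightarrow>
      (\<forall>g\<in>A. X interior_of zero_set X f \<subseteq> zero_set X g \<longrightarrow> g \<in> I)" if "f \<in> A" for f
  proof -
    have "minimal_prime_hull ((cont_ring X)\<lparr>carrier := A\<rparr>) f \<subseteq> A"
      by (auto simp: minimal_prime_hull_def)
    moreover have "g \<in> minimal_prime_hull ((cont_ring X)\<lparr>carrier := A\<rparr>) f \<longleftrightarrow>
        X interior_of zero_set X f \<subseteq> zero_set X g" if "g \<in> A" for g
      using mem_minimal_prime_hull_iff[of f g] \<open>f \<in> A\<close> \<open>g \<in> A\<close>
        annihilator_subset_iff[OF zd sub bdd] by simp
    ultimately show ?thesis by blast
  qed
  moreover have "I \<subseteq> A" if "ideal I ((cont_ring X)\<lparr>carrier := A\<rparr>)"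
    using ideal.Icarr[OF that] by auto
  ultimately show ?thesis unfolding z0_ideal_def by (simp add: subset_iff) blast
qed

text \<open>The case where \<open>A\<close> is the full carrier, since replacing the carrier by
  itself does not change the ring.\<close>

lemma z0_ideal_cont_ring_iff:
  assumes "zero_dimensional X"
  shows "z0_ideal J (cont_ring X) \<longleftrightarrow>
    ideal J (cont_ring X) \<and> J \<noteq> carrier (cont_ring X) \<and>
    (\<forall>f\<in>J. \<forall>g\<in>carrier (cont_ring X). X interior_of zero_set X f \<subseteq> zero_set X g \<longrightarrow> g \<in> J)"
proof -
  interpret cring "cont_ring X" by (rule cring_cont_ring)
  have "cont_countable_bounded X \<subseteq> carrier (cont_ring X)"
    by (auto simp: cont_countable_bounded_def cont_countable_def)
  then show ?thesis using z0_ideal_iff[OF assms carrier_is_subring] by simp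
qed

section \<open>Contraction and extension of ideals\<close>

lemma ideal_contraction:
  fixes R (structure)
  assumes "cring R" "subring A R" "ideal J R"
  shows "ideal (J \<inter> A) (R\<lparr>carrier := A\<rparr>)"
proof -
  interpret cring R by fact
  interpret J: ideal J R by fact
  have sub: "A \<subseteq> carrier R" using assms(2) by (rule subringE)
  interpret A: ring "R\<lparr>carrier := A\<rparr>" using subring_is_ring[OF assms(2)] .
  show ?thesis
  proof (rule idealI)
    show "ring (R\<lparr>carrier := A\<rparr>)" by (rule A.ring_axioms)
    show "subgroup (J \<inter> A) (add_monoid (R\<lparr>carrier := A\<rparr>))"
    proof (rule A.add.subgroupI)
      show "J \<inter> A \<noteq> {}" using J.zero_closed subringE(2)[OF assms(2)] by blast
    next
      \<comment> \<open>Negation in the subring is formed from its own carrier; uniqueness of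
        additive inverses identifies it with negation in \<open>R\<close>.\<close>
      fix a assume a: "a \<in> J \<inter> A"
      have "\<ominus>\<^bsub>R\<lparr>carrier := A\<rparr>\<^esub> a = \<ominus> a"
        using a sub A.add.inv_closed[of a] A.l_neg[of a]
        by (intro minus_equality[symmetric]) auto
      then show "\<ominus>\<^bsub>R\<lparr>carrier := A\<rparr>\<^esub> a \<in> J \<inter> A"
        using a J.a_inv_closed subringE(5)[OF assms(2)] by auto
    qed (use subringE(7)[OF assms(2)] in auto)
  qed (use sub J.I_l_closed J.I_r_closed subringE(6)[OF assms(2)] in auto)
qed

theorem mainTheorem13:
  fixes X :: "'a topology" and A I :: "('a \<Rightarrow> real) set"
  assumes "zero_dimensional X" and "Hausdorff_space X"
    and "subring A (cont_ring X)"
    and "cont_countable_bounded X \<subseteq> A" and "A \<subseteq> cont_countable X"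
    and "I \<subseteq> A"
  shows "z0_ideal I ((cont_ring X)\<lparr>carrier := A\<rparr>) \<longleftrightarrow>
    (\<exists>J. z0_ideal J (cont_ring X) \<and> I = J \<inter> A)"
proof
  let ?C = "cont_ring X"
  let ?Z = "zero_set X"
  interpret C: cring ?C by (rule cring_cont_ring)
  have sub: "A \<subseteq> carrier ?C" using assms(3) by (rule subringE)
  note z0_A = z0_ideal_iff[OF assms(1,3,4)] and z0_C = z0_ideal_cont_ring_iff[OF assms(1)]
  {
    assume "\<exists>J. z0_ideal J ?C \<and> I = J \<inter> A"
    then obtain J where J: "z0_ideal J ?C" and I: "I = J \<inter> A" by blast
    then have ideal: "ideal J ?C" and proper: "J \<noteq> carrier ?C" by (auto simp: z0_C)
    \<comment> \<open>The two rings share their unity, so properness of \<open>J\<close> passes to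
      \<open>I\<close>.\<close>
    have "\<one>\<^bsub>?C\<^esub> \<notin> J" using ideal.one_imp_carrier[OF ideal] proper by blast
    then have "I \<noteq> A" using I subringE(3)[OF assms(3)] by blast
    then show "z0_ideal I (?C\<lparr>carrier := A\<rparr>)"
      using J I sub ideal_contraction[OF C.cring_axioms assms(3) ideal]
      unfolding z0_A z0_C by blast
  next
    assume z0: "z0_ideal I (?C\<lparr>carrier := A\<rparr>)"
    then have ideal: "ideal I (?C\<lparr>carrier := A\<rparr>)" and "I \<noteq> A"
      and z: "\<And>f g. \<lbrakk>f \<in> I; g \<in> A; X interior_of ?Z f \<subseteq> ?Z g\<rbrakk> \<Longrightarrow> g \<in> I"
      by (auto simp: z0_A)
    interpret A: ring "?C\<lparr>carrier := A\<rparr>" using C.subring_is_ring[OF assms(3)] .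
    interpret I: ideal I "?C\<lparr>carrier := A\<rparr>" by fact
    \<comment> \<open>Any z0-ideal of \<open>?C\<close> that contracts to \<open>I\<close> must
      contain these functions, so this is the smallest candidate.\<close>
    define J where "J = {g \<in> carrier ?C. \<exists>f\<in>I. X interior_of ?Z f \<subseteq> ?Z g}"
    \<comment> \<open>One inclusion is the closure condition on \<open>I\<close>; the other takes
      \<open>f = g\<close>, as the interior of a set lies in the set.\<close>
    have JI: "J \<inter> A = I"
      unfolding J_def using z assms(6) sub interior_of_subset by fast
    have "ideal J ?C"
    proof (rule idealI)
      show "ring ?C" by (rule C.ring_axioms)
      show "subgroup J (add_monoid ?C)"
      proof (rule C.add.subgroupI)
        show "J \<noteq> {}" using JI I.zero_closed by blast
      next
        fix g assume "g \<in> J"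
        then obtain f where g: "g \<in> carrier ?C" and f: "f \<in> I" "X interior_of ?Z f \<subseteq> ?Z g"
          by (auto simp: J_def)
        have "(\<ominus>\<^bsub>?C\<^esub> g) x = - g x" if "x \<in> topspace X" for x
        proof -
          have "(\<ominus>\<^bsub>?C\<^esub> g \<oplus>\<^bsub>?C\<^esub> g) x = \<zero>\<^bsub>?C\<^esub> x" using g C.l_neg by simp
          then show ?thesis using that by (simp add: cont_ring_def)
        qed
        then have "?Z (\<ominus>\<^bsub>?C\<^esub> g) = ?Z g" by (auto simp: zero_set_def)
        then show "\<ominus>\<^bsub>?C\<^esub> g \<in> J" using f g by (auto simp: J_def)
      next
        fix g g' assume "g \<in> J" "g' \<in> J"
        then obtain f f' where g: "g \<in> carrier ?C" "g' \<in> carrier ?C" and f: "f \<in> I" "f' \<in> I"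
          and int: "X interior_of ?Z f \<subseteq> ?Z g" "X interior_of ?Z f' \<subseteq> ?Z g'"
          by (auto simp: J_def)
        \<comment> \<open>A single witness for the sum: over the reals, a sum of two squares
          vanishes only where both terms do, and interiors commute with finite
          intersections.\<close>
        let ?h = "f \<otimes>\<^bsub>?C\<^esub> f \<oplus>\<^bsub>?C\<^esub> f' \<otimes>\<^bsub>?C\<^esub> f'"
        have "?h \<in> I"
          using f I.a_closed I.I_l_closed I.Icarr by simp
        moreover have "?Z ?h = ?Z f \<inter> ?Z f'"
          by (auto simp: zero_set_def cont_ring_def sum_squares_eq_zero_iff)
        then have "X interior_of ?Z ?h \<subseteq> ?Z g \<inter> ?Z g'"
          using int by (auto simp: interior_of_Int)
        then have "X interior_of ?Z ?h \<subseteq> ?Z (g \<oplus>\<^bsub>?C\<^esub> g')"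
          by (rule order_trans) (auto simp: zero_set_def cont_ring_def)
        ultimately show "g \<oplus>\<^bsub>?C\<^esub> g' \<in> J"
          using C.add.m_closed[OF g] unfolding J_def by blast
      qed (auto simp: J_def)
    next
      fix g h assume "g \<in> J" and h: "h \<in> carrier ?C"
      then obtain f where g: "g \<in> carrier ?C" and f: "f \<in> I" "X interior_of ?Z f \<subseteq> ?Z g"
        by (auto simp: J_def)
      have "?Z g \<subseteq> ?Z (h \<otimes>\<^bsub>?C\<^esub> g)" by (auto simp: zero_set_def cont_ring_def)
      then show "h \<otimes>\<^bsub>?C\<^esub> g \<in> J"
        using f C.m_closed[OF h g] unfolding J_def by blast
      then show "g \<otimes>\<^bsub>?C\<^esub> h \<in> J" using g h by (simp add: C.m_comm)
    qed
    moreover have "J \<noteq> carrier ?C" using JI \<open>I \<noteq> A\<close> sub by blast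
    moreover have "h \<in> J" if "g \<in> J" "h \<in> carrier ?C" "X interior_of ?Z g \<subseteq> ?Z h" for g h
    proof -
      obtain f where f: "f \<in> I" "X interior_of ?Z f \<subseteq> ?Z g" using \<open>g \<in> J\<close> by (auto simp: J_def)
      \<comment> \<open>The left side is open and contained in \<open>?Z g\<close>, so the witness
        for \<open>g\<close> also serves \<open>h\<close>.\<close>
      have "X interior_of ?Z f \<subseteq> X interior_of ?Z g"
        using f(2) by (simp add: interior_of_maximal)
      then show ?thesis using that f(1) unfolding J_def by blast
    qed
    ultimately have "z0_ideal J ?C" unfolding z0_C by blast
    then show "\<exists>J. z0_ideal J ?C \<and> I = J \<inter> A" using JI by blast
  }
qed

end
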